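(* Let $X_1,X_2,\ldots$ be an infinite sequence of association schemes, with relation sets $I_1,I_2,\ldots$. Then the sequence of wreath products $$(X_1\leftthreetimes\cdots\leftthreetimes X_n)_{n\in\mathbb{N}_{>0}}$$ forms a projective system of association schemes, in which the maps of the underlying sets are the projections $$X_1\times\cdots\times X_n\to X_1\times\cdots\times X_{n-1},$$ and the maps of the sets of relations $$(I_1\setminus\{i_0\})\coprod\cdots\coprod(I_{n-1}\setminus\{i_0\})\coprod I_n\ \to\ (I_1\setminus\{i_0\})\coprod\cdots\coprod(I_{n-2}\setminus\{i_0\})\coprod I_{n-1}$$ are given by mapping all the elements of $I_n$ to $i_0\in I_{n-1}$ (and every other element to itself). The projective limit of the underlying sets is the direct product $$\widehat{X}=\prod_{i=1}^\infty X_i$$ with the direct product topology (hence compact and Hausdorff). The projective limit $\widehat{I}$ of the sets $I_1\leftthreetimes\cdots\leftthreetimes I_n$ is the one-point compactification of the discrete topological space $$\coprod_{i=1}^\infty (I_i\setminus\{i_0\}).$$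
   Context: Association scheme: a triple $(X,R,I)$ with $X,I$ finite sets and $R:X\times X\to I$ a surjection. For $i\in I$ let $A_i$ be the $0/1$ matrix indexed by $X\times X$ with entry $1$ exactly on $R^{-1}(i)$, and let $A_X$ be the complex linear span of the $A_i$. The requirements are: (1) there is $i_0\in I$ with $A_{i_0}$ the identity matrix; (2) $A_X$ is closed under matrix product; (3) $A_X$ is closed under transpose. The symbol $i_0$ is used for the identity relation of every scheme. Morphism from $(X,R,I)$ to $(X',R',I')$: a pair of maps $f:X\to X'$, $\sigma:I\to I'$ with $R'(f(x),f(y))=\sigma(R(x,y))$ for all $x,y\in X$; it is surjective if $f$ is. A projective system of association schemes (profinite association scheme) over a directed ordered set consists of schemes $X_\lambda$ and surjective morphisms $p_{\lambda,\mu}:X_\lambda\to X_\mu$ for $\lambda\ge\mu$, with $p_{\lambda,\lambda}=\mathrm{id}$ and $p_{\lambda,\nu}=p_{\mu,\nu}\circ p_{\lambda,\mu}$. Limits $\widehat X=\varprojlim X_\lambda$, $\widehat I=\varprojlim I_\lambda$ are limits of finite discrete sets, with the limit topology. Wreath product of schemes $(X,R_X,I_X)$ and $(Y,R_Y,I_Y)$: the scheme $X\leftthreetimes Y$ with underlying set $X\times Y$, relation set $I_X\leftthreetimes I_Y:=(I_X\setminus\{i_0\})\coprod I_Y$, and $R_{\leftthreetimes}((x,y),(x',y'))=R_X(x,x')\in I_X\setminus\{i_0\}$ if $x\neq x'$, and $=R_Y(y,y')\in I_Y$ if $x=x'$. The operation is associative, so iterated products need no parentheses; $X_1\leftthreetimes\cdots\leftthreetimes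 X_n$ has underlying set $X_1\times\cdots\times X_n$ and relation set $I_1\leftthreetimes\cdots\leftthreetimes I_n=(I_1\setminus\{i_0\})\coprod\cdots\coprod(I_{n-1}\setminus\{i_0\})\coprod I_n$. One-point compactification of a discrete space $D$: $D\cup\{\infty\}$ with every point of $D$ open and the open neighbourhoods of $\infty$ being the sets $\{\infty\}\cup(D\setminus F)$ with $F\subset D$ finite (if $D$ is finite, $\infty$ is an isolated added point). *)

theory Defs
  imports "HOL-Analysis.Analysis"
begin

section \<open>Association schemes\<close>

text \<open>A triple \<open>(X, R, I)\<close>. Only the values of \<open>rmap\<close> on \<open>pts \<times> pts\<close> are meaningful.\<close>

record ('a, 'i) scheme =
  pts :: "'a set"
  rmap :: "'a \<Rightarrow> 'a \<Rightarrow> 'i"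
  rels :: "'i set"

text \<open>A complex matrix indexed by \<open>X \<times> X\<close> is a function \<open>'a \<Rightarrow> 'a \<Rightarrow> complex\<close> that vanishes
  outside \<open>X \<times> X\<close>.\<close>

definition adjacency :: "('a, 'i) scheme \<Rightarrow> 'i \<Rightarrow> 'a \<Rightarrow> 'a \<Rightarrow> complex" where
  "adjacency S i = (\<lambda>x y. if x \<in> pts S \<and> y \<in> pts S \<and> rmap S x y = i then 1 else 0)"

definition identity_matrix :: "'a set \<Rightarrow> 'a \<Rightarrow> 'a \<Rightarrow> complex" where
  "identity_matrix X = (\<lambda>x y. if x \<in> X \<and> y \<in> X \<and> x = y then 1 else 0)"

definition matrix_product ::
    "'a set \<Rightarrow> ('a \<Rightarrow> 'a \<Rightarrow> complex) \<Rightarrow> ('a \<Rightarrow> 'a \<Rightarrow> complex) \<Rightarrow> 'a \<Rightarrow> 'a \<Rightarrow> complex" where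
  "matrix_product X M N = (\<lambda>x y. \<Sum>z\<in>X. M x z * N z y)"

definition matrix_transpose :: "('a \<Rightarrow> 'a \<Rightarrow> complex) \<Rightarrow> 'a \<Rightarrow> 'a \<Rightarrow> complex" where
  "matrix_transpose M = (\<lambda>x y. M y x)"

definition adjacency_span :: "('a, 'i) scheme \<Rightarrow> ('a \<Rightarrow> 'a \<Rightarrow> complex) set" where
  "adjacency_span S = {M. \<exists>c. M = (\<lambda>x y. \<Sum>i\<in>rels S. c i * adjacency S i x y)}"

definition association_scheme :: "('a, 'i) scheme \<Rightarrow> bool" where
  "association_scheme S \<longleftrightarrow>
     finite (pts S) \<and> finite (rels S) \<and>
     (\<lambda>(x, y). rmap S x y) ` (pts S \<times> pts S) = rels S \<and>
     (\<exists>i0\<in>rels S. adjacency S i0 = identity_matrix (pts S)) \<and>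
     (\<forall>M\<in>adjacency_span S. \<forall>N\<in>adjacency_span S. matrix_product (pts S) M N \<in> adjacency_span S) \<and>
     (\<forall>M\<in>adjacency_span S. matrix_transpose M \<in> adjacency_span S)"

text \<open>The identity relation \<open>i\<^sub>0\<close>; the axioms force \<open>pts S \<noteq> {}\<close>, so it is unique.\<close>

definition scheme_id :: "('a, 'i) scheme \<Rightarrow> 'i" where
  "scheme_id S = (THE i. i \<in> rels S \<and> adjacency S i = identity_matrix (pts S))"

lemma scheme_idI:
  assumes "i \<in> rels S" "pts S \<noteq> {}"
    and "\<And>x y. x \<in> pts S \<Longrightarrow> y \<in> pts S \<Longrightarrow> rmap S x y = i \<longleftrightarrow> x = y"
  shows "scheme_id S = i"
  unfolding scheme_id_def
proof (rule the_equality)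
  show "i \<in> rels S \<and> adjacency S i = identity_matrix (pts S)"
    using assms by (auto simp: adjacency_def identity_matrix_def fun_eq_iff)
  fix j assume j: "j \<in> rels S \<and> adjacency S j = identity_matrix (pts S)"
  obtain x where x: "x \<in> pts S" using assms(2) by blast
  have "adjacency S j x x = 1" using j x by (simp add: identity_matrix_def)
  then have "rmap S x x = j" by (auto simp: adjacency_def split: if_splits)
  then show "j = i" using assms(3) x by blast
qed

lemma association_scheme_id:
  assumes "association_scheme S"
  shows "pts S \<noteq> {}" "scheme_id S \<in> rels S"
    and "\<And>x y. x \<in> pts S \<Longrightarrow> y \<in> pts S \<Longrightarrow> rmap S x y = scheme_id S \<longleftrightarrow> x = y"
proof -
  obtain i where i: "i \<in> rels S" "adjacency S i = identity_matrix (pts S)"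
    using assms by (auto simp: association_scheme_def)
  show ne: "pts S \<noteq> {}"
    using assms i(1) by (auto simp: association_scheme_def)
  have *: "rmap S x y = i \<longleftrightarrow> x = y" if "x \<in> pts S" "y \<in> pts S" for x y
    using that fun_cong[OF fun_cong[OF i(2)], of x y]
    by (auto simp: adjacency_def identity_matrix_def split: if_splits)
  have "scheme_id S = i" using i(1) ne * by (rule scheme_idI)
  then show "scheme_id S \<in> rels S"
    and "\<And>x y. x \<in> pts S \<Longrightarrow> y \<in> pts S \<Longrightarrow> rmap S x y = scheme_id S \<longleftrightarrow> x = y"
    using i(1) * by auto
qed

section \<open>Morphisms and projective systems\<close>

definition scheme_morphism ::
    "('a, 'i) scheme \<Rightarrow> ('b, 'j) scheme \<Rightarrow> ('a \<Rightarrow> 'b) \<Rightarrow> ('i \<Rightarrow> 'j) \<Rightarrow> bool" where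
  "scheme_morphism S T f s \<longleftrightarrow>
     f ` pts S \<subseteq> pts T \<and> s ` rels S \<subseteq> rels T \<and>
     (\<forall>x\<in>pts S. \<forall>y\<in>pts S. rmap T (f x) (f y) = s (rmap S x y))"

definition surjective_scheme_morphism ::
    "('a, 'i) scheme \<Rightarrow> ('b, 'j) scheme \<Rightarrow> ('a \<Rightarrow> 'b) \<Rightarrow> ('i \<Rightarrow> 'j) \<Rightarrow> bool" where
  "surjective_scheme_morphism S T f s \<longleftrightarrow> scheme_morphism S T f s \<and> f ` pts S = pts T"

definition directed_set :: "'l::order set \<Rightarrow> bool" where
  "directed_set L \<longleftrightarrow> L \<noteq> {} \<and> (\<forall>a\<in>L. \<forall>b\<in>L. \<exists>c\<in>L. a \<le> c \<and> b \<le> c)"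

text \<open>For \<open>m \<le> l\<close> the transition morphism from \<open>X l\<close> to \<open>X m\<close> is the pair \<open>(p l m, q l m)\<close> of a
  map of points and a map of relations. The functor laws are required on the carriers.\<close>

definition projective_system ::
    "'l::order set \<Rightarrow> ('l \<Rightarrow> ('a, 'i) scheme) \<Rightarrow> ('l \<Rightarrow> 'l \<Rightarrow> 'a \<Rightarrow> 'a) \<Rightarrow> ('l \<Rightarrow> 'l \<Rightarrow> 'i \<Rightarrow> 'i) \<Rightarrow> bool"
  where
  "projective_system L X p q \<longleftrightarrow>
     directed_set L \<and>
     (\<forall>l\<in>L. association_scheme (X l)) \<and>
     (\<forall>l\<in>L. \<forall>m\<in>L. m \<le> l \<longrightarrow> surjective_scheme_morphism (X l) (X m) (p l m) (q l m)) \<and>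
     (\<forall>l\<in>L. (\<forall>x\<in>pts (X l). p l l x = x) \<and> (\<forall>i\<in>rels (X l). q l l i = i)) \<and>
     (\<forall>l\<in>L. \<forall>m\<in>L. \<forall>n\<in>L. n \<le> m \<longrightarrow> m \<le> l \<longrightarrow>
        (\<forall>x\<in>pts (X l). p l n x = p m n (p l m x)) \<and>
        (\<forall>i\<in>rels (X l). q l n i = q m n (q l m i)))"

text \<open>Limit of sets \<open>A l\<close> with transition maps \<open>f l m : A l \<rightarrow> A m\<close>, with the topology induced from
  the product of the discrete spaces \<open>A l\<close>.\<close>

definition projective_limit_set :: "'l::order set \<Rightarrow> ('l \<Rightarrow> 'a set) \<Rightarrow> ('l \<Rightarrow> 'l \<Rightarrow> 'a \<Rightarrow> 'a) \<Rightarrow> ('l \<Rightarrow> 'a) set"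
  where
  "projective_limit_set L A f =
     {x \<in> Pi\<^sub>E L A. \<forall>l\<in>L. \<forall>m\<in>L. m \<le> l \<longrightarrow> f l m (x l) = x m}"

definition projective_limit ::
    "'l::order set \<Rightarrow> ('l \<Rightarrow> 'a set) \<Rightarrow> ('l \<Rightarrow> 'l \<Rightarrow> 'a \<Rightarrow> 'a) \<Rightarrow> ('l \<Rightarrow> 'a) topology" where
  "projective_limit L A f =
     subtopology (product_topology (\<lambda>l. discrete_topology (A l)) L) (projective_limit_set L A f)"

text \<open>For a sequence of maps \<open>f n : A n \<rightarrow> A (n - 1)\<close> and \<open>m \<le> n\<close>, \<open>composite f n m\<close> is
  \<open>f (m + 1) \<circ> \<dots> \<circ> f n : A n \<rightarrow> A m\<close>. In particular \<open>composite f n n = id\<close>.\<close>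

primrec composite :: "(nat \<Rightarrow> 'a \<Rightarrow> 'a) \<Rightarrow> nat \<Rightarrow> nat \<Rightarrow> 'a \<Rightarrow> 'a" where
  "composite f 0 m = id"
| "composite f (Suc n) m = (if m \<le> n then composite f n m \<circ> f (Suc n) else id)"

lemma composite_self: "composite f n n = id"
  by (cases n) auto

lemma composite_step: "n \<ge> 1 \<Longrightarrow> composite f n (n - 1) = f n"
  by (cases n) (auto simp: composite_self)

section \<open>Wreath products\<close>

definition wreath :: "('a, 'i) scheme \<Rightarrow> ('b, 'j) scheme \<Rightarrow> ('a \<times> 'b, 'i + 'j) scheme" where
  "wreath S T =
     \<lparr>pts = pts S \<times> pts T,
      rmap = (\<lambda>(x, y) (x', y'). if x \<noteq> x' then Inl (rmap S x x') else Inr (rmap T y y')),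
      rels = (rels S - {scheme_id S}) <+> rels T\<rparr>"

text \<open>The iterated product of \<open>S 1, \<dots>, S n\<close>. Points are extensional functions on \<open>{1..n}\<close>; an
  element \<open>i\<close> of the \<open>k\<close>-th summand of the relation set is encoded as the pair \<open>(k, i)\<close>. Unfolding
  the binary product, two tuples are related by the relation of their components at the first index
  \<open>k < n\<close> at which they differ, and by the relation of their \<open>n\<close>-th components if there is no such
  \<open>k\<close>. The lemmas \<open>iterated_wreath_1\<close> and \<open>iterated_wreath_Suc\<close> below
  relate this to iteration of \<open>wreath\<close>.\<close>

definition wreath_index :: "nat \<Rightarrow> (nat \<Rightarrow> 'a) \<Rightarrow> (nat \<Rightarrow> 'a) \<Rightarrow> nat" where
  "wreath_index n x y = (LEAST k. 1 \<le> k \<and> (x k \<noteq> y k \<or> k = n))"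

definition iterated_wreath :: "(nat \<Rightarrow> ('a, 'i) scheme) \<Rightarrow> nat \<Rightarrow> (nat \<Rightarrow> 'a, nat \<times> 'i) scheme" where
  "iterated_wreath S n =
     \<lparr>pts = (\<Pi>\<^sub>E k\<in>{1..n}. pts (S k)),
      rmap = (\<lambda>x y. let k = wreath_index n x y in (k, rmap (S k) (x k) (y k))),
      rels = (SIGMA k:{1..<n}. rels (S k) - {scheme_id (S k)}) \<union> {n} \<times> rels (S n)\<rparr>"

lemma wreath_index_differ:
  assumes "1 \<le> k" "k < n" "x k \<noteq> y k" "\<And>j. 1 \<le> j \<Longrightarrow> j < k \<Longrightarrow> x j = y j"
  shows "wreath_index n x y = k"
  unfolding wreath_index_def
  by (rule Least_equality) (use assms in \<open>auto simp: not_less[symmetric]\<close>)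

lemma wreath_index_last:
  assumes "1 \<le> n" "\<And>j. 1 \<le> j \<Longrightarrow> j < n \<Longrightarrow> x j = y j"
  shows "wreath_index n x y = n"
  unfolding wreath_index_def
  by (rule Least_equality) (use assms in \<open>auto simp: not_less[symmetric]\<close>)

lemma wreath_index_cases:
  fixes x y :: "nat \<Rightarrow> 'a"
  assumes "1 \<le> n"
  obtains (differ) k where "1 \<le> k" "k < n" "x k \<noteq> y k" "\<And>j. 1 \<le> j \<Longrightarrow> j < k \<Longrightarrow> x j = y j"
  | (last) "\<And>j. 1 \<le> j \<Longrightarrow> j < n \<Longrightarrow> x j = y j"
proof (cases "\<exists>k. 1 \<le> k \<and> k < n \<and> x k \<noteq> y k")
  case True
  define k where "k = (LEAST k. 1 \<le> k \<and> k < n \<and> x k \<noteq> y k)"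
  have "1 \<le> k \<and> k < n \<and> x k \<noteq> y k"
    using LeastI_ex[of "\<lambda>k. 1 \<le> k \<and> k < n \<and> x k \<noteq> y k"] True unfolding k_def by blast
  moreover have "x j = y j" if "1 \<le> j" "j < k" for j
    using not_less_Least[of j "\<lambda>k. 1 \<le> k \<and> k < n \<and> x k \<noteq> y k"] that calculation
    unfolding k_def[symmetric] by auto
  ultimately show ?thesis using differ by blast
next
  case False
  then show ?thesis using last by blast
qed

lemma scheme_id_iterated_wreath:
  assumes S: "\<And>k. 1 \<le> k \<Longrightarrow> association_scheme (S k)" and n: "1 \<le> n"
  shows "scheme_id (iterated_wreath S n) = (n, scheme_id (S n))"
proof (rule scheme_idI)
  show "(n, scheme_id (S n)) \<in> rels (iterated_wreath S n)"
    using association_scheme_id(2)[OF S[OF n]] by (simp add: iterated_wreath_def)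
  show "pts (iterated_wreath S n) \<noteq> {}"
    using association_scheme_id(1)[OF S] by (auto simp: iterated_wreath_def PiE_eq_empty_iff)
  fix x y assume xy: "x \<in> pts (iterated_wreath S n)" "y \<in> pts (iterated_wreath S n)"
  then have x: "x k \<in> pts (S k)" and y: "y k \<in> pts (S k)" if "1 \<le> k" "k \<le> n" for k
    using that by (auto simp: iterated_wreath_def PiE_iff)
  show "rmap (iterated_wreath S n) x y = (n, scheme_id (S n)) \<longleftrightarrow> x = y"
    using n
  proof (cases rule: wreath_index_cases[of n x y])
    case (differ k)
    then show ?thesis using wreath_index_differ[of k n x y]
      by (auto simp: iterated_wreath_def Let_def)
  next
    case last
    have "x = y" if "x n = y n"
    proof (rule PiE_ext)
      show "x \<in> (\<Pi>\<^sub>E k\<in>{1..n}. pts (S k))" "y \<in> (\<Pi>\<^sub>E k\<in>{1..n}. pts (S k))"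
        using xy by (simp_all add: iterated_wreath_def)
      fix k assume "k \<in> {1..n}"
      then show "x k = y k" using last[of k] that by (cases "k = n") auto
    qed
    moreover have "rmap (S n) (x n) (y n) = scheme_id (S n) \<longleftrightarrow> x n = y n"
      using association_scheme_id(3)[OF S[OF n] x[OF n] y[OF n]] by simp
    ultimately show ?thesis using wreath_index_last[OF n last]
      by (auto simp: iterated_wreath_def Let_def)
  qed
qed

definition scheme_isomorphism ::
    "('a, 'i) scheme \<Rightarrow> ('b, 'j) scheme \<Rightarrow> ('a \<Rightarrow> 'b) \<Rightarrow> ('i \<Rightarrow> 'j) \<Rightarrow> bool" where
  "scheme_isomorphism S T f s \<longleftrightarrow>
     scheme_morphism S T f s \<and> bij_betw f (pts S) (pts T) \<and> bij_betw s (rels S) (rels T)"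

lemma iterated_wreath_1:
  "scheme_isomorphism (iterated_wreath S 1) (S 1) (\<lambda>x. x 1) snd"
proof -
  have [simp]: "wreath_index (Suc 0) x y = Suc 0" for x y :: "nat \<Rightarrow> 'a"
    using wreath_index_last[of "Suc 0" x y] by simp
  have "bij_betw (\<lambda>x. x 1) (\<Pi>\<^sub>E k\<in>{1..1}. pts (S k)) (pts (S 1))"
    by (rule bij_betw_byWitness[where f' = "\<lambda>a. \<lambda>k\<in>{1..1}. a"])
      (auto simp: PiE_iff extensional_def fun_eq_iff split: if_splits)
  moreover have "bij_betw snd ({Suc 0} \<times> rels (S 1)) (rels (S 1))"
    by (rule bij_betw_byWitness[where f' = "Pair 1"]) auto
  ultimately show ?thesis
    by (auto simp: scheme_isomorphism_def scheme_morphism_def iterated_wreath_def Let_def)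
qed

lemma iterated_wreath_Suc:
  assumes S: "\<And>k. 1 \<le> k \<Longrightarrow> association_scheme (S k)" and n: "1 \<le> n"
  shows "scheme_isomorphism (wreath (iterated_wreath S n) (S (Suc n))) (iterated_wreath S (Suc n))
           (\<lambda>(x, a). x(Suc n := a)) (case_sum (\<lambda>i. i) (\<lambda>j. (Suc n, j)))"
    (is "scheme_isomorphism ?W ?V ?f ?s")
proof -
  note id = scheme_id_iterated_wreath[OF S n]
  have pW: "pts ?W = (\<Pi>\<^sub>E k\<in>{1..n}. pts (S k)) \<times> pts (S (Suc n))"
    by (simp add: wreath_def iterated_wreath_def)
  have pV: "pts ?V = (\<Pi>\<^sub>E k\<in>{1..Suc n}. pts (S k))"
    by (simp add: iterated_wreath_def)
  have bf: "bij_betw ?f (pts ?W) (pts ?V)"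
    unfolding pW pV
    by (rule bij_betw_byWitness[where f' = "\<lambda>x. (restrict x {1..n}, x (Suc n))"])
      (auto simp: PiE_iff extensional_def fun_eq_iff)
  have rW: "rels ?W = (SIGMA k:{1..n}. rels (S k) - {scheme_id (S k)}) <+> rels (S (Suc n))"
  proof -
    have "rels (iterated_wreath S n) - {(n, scheme_id (S n))}
        = (SIGMA k:{1..n}. rels (S k) - {scheme_id (S k)})"
      using n by (auto simp: iterated_wreath_def le_less)
    then show ?thesis by (simp add: wreath_def id)
  qed
  have rV: "rels ?V = (SIGMA k:{1..n}. rels (S k) - {scheme_id (S k)}) \<union> {Suc n} \<times> rels (S (Suc n))"
    by (auto simp: iterated_wreath_def)
  have bs: "bij_betw ?s (rels ?W) (rels ?V)"
    unfolding rW rV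
    by (rule bij_betw_byWitness[where
          f' = "\<lambda>(k, i). if k = Suc n then Inr i else Inl (k, i)"]) (auto split: if_splits)
  have "rmap ?V (?f u) (?f v) = ?s (rmap ?W u v)" if uv: "u \<in> pts ?W" "v \<in> pts ?W" for u v
  proof -
    obtain x a where u: "u = (x, a)" by force
    obtain y b where v: "v = (y, b)" by force
    have xy: "x \<in> (\<Pi>\<^sub>E k\<in>{1..n}. pts (S k))" "y \<in> (\<Pi>\<^sub>E k\<in>{1..n}. pts (S k))"
      using uv u v by (auto simp: pW)
    show ?thesis
    proof (cases "x = y")
      case True
      have "wreath_index (Suc n) (x(Suc n := a)) (y(Suc n := b)) = Suc n"
        by (rule wreath_index_last) (use True in auto)
      then show ?thesis using True
        by (simp add: u v iterated_wreath_def wreath_def Let_def)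
    next
      case False
      define P where "P k \<longleftrightarrow> 1 \<le> k \<and> k \<le> n \<and> x k \<noteq> y k" for k
      have ex: "\<exists>k. P k"
      proof (rule ccontr)
        assume "\<nexists>k. P k"
        then have "x = y" using xy by (intro PiE_ext[OF xy]) (auto simp: P_def)
        then show False using False by simp
      qed
      define k where "k = (LEAST k. P k)"
      have k: "1 \<le> k" "k \<le> n" "x k \<noteq> y k"
        using LeastI_ex[OF ex] unfolding k_def[symmetric] by (simp_all add: P_def)
      have below: "x j = y j" if "1 \<le> j" "j < k" for j
        using not_less_Least[of j P] that k unfolding k_def[symmetric] by (simp add: P_def)
      have 1: "wreath_index (Suc n) (x(Suc n := a)) (y(Suc n := b)) = k"
        by (rule wreath_index_differ) (use k below in auto)
      have 2: "wreath_index n x y = k"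
      proof (cases "k = n")
        case True
        then show ?thesis using wreath_index_last[OF n] below by blast
      next
        case False
        then show ?thesis using wreath_index_differ[of k n x y] k below by simp
      qed
      show ?thesis using False k(2) 1 2
        by (auto simp: u v iterated_wreath_def wreath_def Let_def)
    qed
  qed
  moreover have "?f ` pts ?W \<subseteq> pts ?V" "?s ` rels ?W \<subseteq> rels ?V"
    using bf bs by (auto simp: bij_betw_def)
  ultimately show ?thesis
    using bf bs unfolding scheme_isomorphism_def scheme_morphism_def by blast
qed

section \<open>The projective system of iterated wreath products\<close>

definition wreath_point_step :: "nat \<Rightarrow> (nat \<Rightarrow> 'a) \<Rightarrow> nat \<Rightarrow> 'a" where
  "wreath_point_step n x = restrict x {1..n - 1}"

definition wreath_relation_step :: "(nat \<Rightarrow> ('a, 'i) scheme) \<Rightarrow> nat \<Rightarrow> nat \<times> 'i \<Rightarrow> nat \<times> 'i" where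
  "wreath_relation_step S n = (\<lambda>(k, i). if k = n then (n - 1, scheme_id (S (n - 1))) else (k, i))"

text \<open>The canonical maps into the two limits. In the second one \<open>Some (k, i)\<close>, with
  \<open>i \<noteq> scheme_id (S k)\<close>, is the compatible family equal to \<open>i\<close> from level \<open>k\<close> on and to the identity
  relation below, and \<open>None\<close> (the point at infinity) is the family of identity relations.\<close>

definition product_to_limit :: "(nat \<Rightarrow> 'a) \<Rightarrow> nat \<Rightarrow> nat \<Rightarrow> 'a" where
  "product_to_limit x = (\<lambda>n\<in>{1..}. restrict x {1..n})"

definition compactification_to_limit ::
    "(nat \<Rightarrow> ('a, 'i) scheme) \<Rightarrow> (nat \<times> 'i) option \<Rightarrow> nat \<Rightarrow> nat \<times> 'i" where
  "compactification_to_limit S d =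
     (\<lambda>n\<in>{1..}. case d of
         None \<Rightarrow> (n, scheme_id (S n))
       | Some (k, i) \<Rightarrow> if k \<le> n then (k, i) else (n, scheme_id (S n)))"

text \<open>The library's \<open>Alexandroff_compactification\<close> of a discrete space, with \<open>None\<close> as the point at
  infinity, is the one-point compactification in the elementary sense, including the case of finite
  \<open>D\<close>, where \<open>None\<close> is isolated.\<close>

lemma openin_Alexandroff_compactification_discrete:
  "openin (Alexandroff_compactification (discrete_topology D)) V \<longleftrightarrow>
     (\<exists>U\<subseteq>D. V = Some ` U) \<or> (\<exists>F\<subseteq>D. finite F \<and> V = insert None (Some ` (D - F)))"
  by (auto simp: openin_Alexandroff_compactification compactin_discrete_topology)

end

theory Submission
  imports Defs
begin

text \<open>
  Three things have to be seen: that iterated wreath products are again association schemes, that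
  truncation of tuples respects the relations, and what the two limits are.

  For the first, it is convenient to replace matrices in the span of the \<open>A\<^sub>i\<close> by their
  coefficient functions \<open>c\<close> on relations, the matrix being \<open>c (R x y)\<close>
  (\<open>association_scheme_iff\<close>). In a wreath product \<open>X \<leftthreetimes> Y\<close> such a matrix is
  \<open>M\<^sub>1 \<otimes> J + 1 \<otimes> M\<^sub>2\<close>, with \<open>M\<^sub>1\<close> in the span for \<open>X\<close> and zero on the diagonal,
  \<open>M\<^sub>2\<close> in the span for \<open>Y\<close>, and \<open>J\<close> the all-one matrix on \<open>Y\<close>. Products of such matrices are
  computed from \<open>J J = |Y| J\<close> and from the fact that \<open>M\<^sub>2 J\<close> and \<open>J M\<^sub>2\<close> are multiples of \<open>J\<close>,
  because row and column sums are constant in a scheme (\<open>association_scheme_wreath\<close>).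
  Induction along \<open>iterated_wreath_Suc\<close> gives all iterated products.

  The second is a comparison of the first index at which two tuples differ with the length \<open>m\<close> of
  the truncation: an index up to \<open>m\<close> is seen unchanged at level \<open>m\<close>, and if the first difference
  comes after \<open>m\<close> the truncated tuples coincide (\<open>rmap_iterated_wreath_restrict\<close>).

  For the limits, both canonical maps are continuous bijections from a compact space onto a
  Hausdorff space, hence homeomorphisms. A compatible family of truncated tuples is one infinite
  tuple. A compatible family of relations which is not the identity at some level is constantly one
  relation \<open>(k, i)\<close> from level \<open>k\<close> on and the identity below \<open>k\<close>, since a transition map changes a
  relation only by sending it to the identity. Continuity at infinity holds because at each level
  only the finitely many \<open>(k, i)\<close> with \<open>k \<le> n\<close> differ from the identity.
\<close>

section \<open>Association schemes in terms of coefficient functions\<close>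

lemma adjacency_span_iff:
  assumes "finite (rels S)" "(\<lambda>(x, y). rmap S x y) ` (pts S \<times> pts S) = rels S"
  shows "M \<in> adjacency_span S \<longleftrightarrow>
    (\<exists>c. M = (\<lambda>x y. if x \<in> pts S \<and> y \<in> pts S then c (rmap S x y) else 0))"
proof -
  have "(\<Sum>i\<in>rels S. c i * adjacency S i x y) =
      (if x \<in> pts S \<and> y \<in> pts S then c (rmap S x y) else 0)" for c x y
  proof (cases "x \<in> pts S \<and> y \<in> pts S")
    case True
    then have "rmap S x y \<in> rels S" using assms(2) by force
    moreover have "(\<Sum>i\<in>rels S. c i * adjacency S i x y) =
        (\<Sum>i\<in>rels S. if i = rmap S x y then c i else 0)"
      by (rule sum.cong) (use True in \<open>auto simp: adjacency_def\<close>)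
    ultimately show ?thesis using True assms(1) by simp
  qed (auto simp: adjacency_def intro!: sum.neutral)
  then show ?thesis unfolding adjacency_span_def by simp
qed

text \<open>Matrices in the span of the \<open>A\<^sub>i\<close> are exactly those whose entries depend only on the relation, so
  the closure axioms become statements about functions of relations. In this form they can be
  transported along isomorphisms and checked for wreath products by computing with sums.\<close>

lemma association_scheme_iff:
  "association_scheme S \<longleftrightarrow>
     finite (pts S) \<and> finite (rels S) \<and>
     (\<lambda>(x, y). rmap S x y) ` (pts S \<times> pts S) = rels S \<and>
     (\<exists>i0\<in>rels S. \<forall>x\<in>pts S. \<forall>y\<in>pts S. rmap S x y = i0 \<longleftrightarrow> x = y) \<and>
     (\<forall>c d :: 'i \<Rightarrow> complex. \<exists>e. \<forall>x\<in>pts S. \<forall>y\<in>pts S.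
        (\<Sum>z\<in>pts S. c (rmap S x z) * d (rmap S z y)) = e (rmap S x y)) \<and>
     (\<forall>c :: 'i \<Rightarrow> complex. \<exists>e. \<forall>x\<in>pts S. \<forall>y\<in>pts S. c (rmap S y x) = e (rmap S x y))"
  for S :: "('a, 'i) scheme"
proof (cases "finite (rels S) \<and> (\<lambda>(x, y). rmap S x y) ` (pts S \<times> pts S) = rels S")
  case True
  define mat where "mat c = (\<lambda>x y. if x \<in> pts S \<and> y \<in> pts S then c (rmap S x y) else 0)"
    for c :: "'i \<Rightarrow> complex"
  have span: "adjacency_span S = range mat"
    using True by (auto simp: adjacency_span_iff mat_def)
  have id: "adjacency S i = identity_matrix (pts S) \<longleftrightarrow>
      (\<forall>x\<in>pts S. \<forall>y\<in>pts S. rmap S x y = i \<longleftrightarrow> x = y)" for i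
    by (auto simp: adjacency_def identity_matrix_def fun_eq_iff)
  have prod: "matrix_product (pts S) (mat c) (mat d) = mat e \<longleftrightarrow>
      (\<forall>x\<in>pts S. \<forall>y\<in>pts S.
         (\<Sum>z\<in>pts S. c (rmap S x z) * d (rmap S z y)) = e (rmap S x y))" for c d e
    by (auto simp: matrix_product_def mat_def fun_eq_iff cong: sum.cong)
  have transp: "matrix_transpose (mat c) = mat e \<longleftrightarrow>
      (\<forall>x\<in>pts S. \<forall>y\<in>pts S. c (rmap S y x) = e (rmap S x y))" for c e
    by (auto simp: matrix_transpose_def mat_def fun_eq_iff)
  show ?thesis
    unfolding association_scheme_def span id using True
    by (simp add: image_iff prod transp)
qed (auto simp: association_scheme_def)

lemma association_scheme_product_coefficients:
  assumes "association_scheme S"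
  shows "\<exists>e. \<forall>x\<in>pts S. \<forall>y\<in>pts S.
    (\<Sum>z\<in>pts S. c (rmap S x z) * d (rmap S z y)) = (e (rmap S x y) :: complex)"
  by (rule assms[unfolded association_scheme_iff, THEN conjunct2, THEN conjunct2, THEN conjunct2,
        THEN conjunct2, THEN conjunct1, rule_format])

lemma association_scheme_transpose_coefficients:
  assumes "association_scheme S"
  shows "\<exists>e. \<forall>x\<in>pts S. \<forall>y\<in>pts S. c (rmap S y x) = (e (rmap S x y) :: complex)"
  by (rule assms[unfolded association_scheme_iff, THEN conjunct2, THEN conjunct2, THEN conjunct2,
        THEN conjunct2, THEN conjunct2, rule_format])

lemma association_scheme_rmap:
  assumes "association_scheme S" "x \<in> pts S" "y \<in> pts S"
  shows "rmap S x y \<in> rels S"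
  using assms by (force simp: association_scheme_def)

text \<open>Coefficient functions on \<open>T\<close> are pulled back along \<open>s\<close>, and those obtained on \<open>S\<close> are pushed
  forward along its inverse; the sums are reindexed by \<open>f\<close>.\<close>

lemma scheme_isomorphism_preserves_association_scheme:
  fixes S :: "('a, 'i) scheme" and T :: "('b, 'j) scheme"
  assumes iso: "scheme_isomorphism S T f s" and S: "association_scheme S"
  shows "association_scheme T"
proof -
  have f: "bij_betw f (pts S) (pts T)" and s: "bij_betw s (rels S) (rels T)"
    and R: "\<And>x y. x \<in> pts S \<Longrightarrow> y \<in> pts S \<Longrightarrow> rmap T (f x) (f y) = s (rmap S x y)"
    using iso by (auto simp: scheme_isomorphism_def scheme_morphism_def)
  note rel = association_scheme_rmap[OF S]
  have pts_T: "pts T = f ` pts S" and inj_f: "inj_on f (pts S)"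
    and rels_T: "rels T = s ` rels S" and inj_s: "inj_on s (rels S)"
    using f s by (auto simp: bij_betw_def)
  define t where "t = inv_into (rels S) s"
  have t: "t (s i) = i" if "i \<in> rels S" for i
    using inj_s that by (simp add: t_def)
  have "finite (pts T)" "finite (rels T)"
    using S by (simp_all add: pts_T rels_T association_scheme_def)
  moreover have "(\<lambda>(x, y). rmap T x y) ` (pts T \<times> pts T) = rels T"
  proof -
    have "(\<lambda>(x, y). rmap T x y) ` (pts T \<times> pts T) = (\<lambda>(x, y). s (rmap S x y)) ` (pts S \<times> pts S)"
      by (force simp: pts_T R image_iff)
    also have "\<dots> = s ` ((\<lambda>(x, y). rmap S x y) ` (pts S \<times> pts S))"
      by (simp add: image_image case_prod_unfold)
    finally show ?thesis
      using S by (simp add: rels_T association_scheme_def)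
  qed
  moreover have "\<exists>i0\<in>rels T. \<forall>x\<in>pts T. \<forall>y\<in>pts T. rmap T x y = i0 \<longleftrightarrow> x = y"
  proof (intro bexI[of _ "s (scheme_id S)"] ballI)
    fix x' y' assume "x' \<in> pts T" "y' \<in> pts T"
    then obtain x y where xy: "x' = f x" "y' = f y" "x \<in> pts S" "y \<in> pts S"
      by (auto simp: pts_T)
    have "rmap T x' y' = s (scheme_id S) \<longleftrightarrow> rmap S x y = scheme_id S"
      using xy inj_on_eq_iff[OF inj_s rel[of x y] association_scheme_id(2)[OF S]] by (simp add: R)
    also have "\<dots> \<longleftrightarrow> x' = y'"
      using xy association_scheme_id(3)[OF S] inj_on_eq_iff[OF inj_f] by simp
    finally show "rmap T x' y' = s (scheme_id S) \<longleftrightarrow> x' = y'" .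
  qed (use association_scheme_id(2)[OF S] in \<open>simp add: rels_T\<close>)
  moreover have "\<exists>e. \<forall>x\<in>pts T. \<forall>y\<in>pts T.
      (\<Sum>z\<in>pts T. c (rmap T x z) * d (rmap T z y)) = e (rmap T x y)" for c d :: "'j \<Rightarrow> complex"
  proof -
    obtain e where e: "\<forall>x\<in>pts S. \<forall>y\<in>pts S.
        (\<Sum>z\<in>pts S. c (s (rmap S x z)) * d (s (rmap S z y))) = e (rmap S x y)"
      using association_scheme_product_coefficients[OF S, of "c \<circ> s" "d \<circ> s"] by auto
    show ?thesis
      by (rule exI[of _ "e \<circ> t"])
        (auto simp: pts_T sum.reindex[OF inj_f] R t rel e cong: sum.cong)
  qed
  moreover have "\<exists>e. \<forall>x\<in>pts T. \<forall>y\<in>pts T. c (rmap T y x) = e (rmap T x y)"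
    for c :: "'j \<Rightarrow> complex"
  proof -
    obtain e where e: "\<forall>x\<in>pts S. \<forall>y\<in>pts S. c (s (rmap S y x)) = e (rmap S x y)"
      using association_scheme_transpose_coefficients[OF S, of "c \<circ> s"] by auto
    show ?thesis
      by (rule exI[of _ "e \<circ> t"]) (auto simp: pts_T R t rel e)
  qed
  ultimately show ?thesis unfolding association_scheme_iff by (intro conjI allI)
qed

section \<open>Wreath products are association schemes\<close>

text \<open>The product of the matrix of \<open>c\<close> with the all-one matrix has constant rows, and being in the span
  it is constant on the diagonal; hence the row sums all agree.\<close>

lemma association_scheme_row_sum:
  fixes c :: "'i \<Rightarrow> complex" and S :: "('a, 'i) scheme"
  assumes S: "association_scheme S"
  obtains r where "\<And>x. x \<in> pts S \<Longrightarrow> (\<Sum>z\<in>pts S. c (rmap S x z)) = r"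
proof -
  obtain e where "\<forall>x\<in>pts S. \<forall>y\<in>pts S. (\<Sum>z\<in>pts S. c (rmap S x z) * 1) = e (rmap S x y)"
    using association_scheme_product_coefficients[OF S, of c "\<lambda>_. 1"] by blast
  then have "(\<Sum>z\<in>pts S. c (rmap S x z)) = e (scheme_id S)" if "x \<in> pts S" for x
    using that association_scheme_id(3)[OF S, of x x] by simp
  then show ?thesis by (rule that)
qed

lemma association_scheme_column_sum:
  fixes c :: "'i \<Rightarrow> complex" and S :: "('a, 'i) scheme"
  assumes S: "association_scheme S"
  obtains r where "\<And>y. y \<in> pts S \<Longrightarrow> (\<Sum>z\<in>pts S. c (rmap S z y)) = r"
proof -
  obtain e where e: "\<forall>x\<in>pts S. \<forall>y\<in>pts S. c (rmap S y x) = e (rmap S x y)"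
    using association_scheme_transpose_coefficients[OF S] by blast
  obtain r where r: "\<And>x. x \<in> pts S \<Longrightarrow> (\<Sum>z\<in>pts S. e (rmap S x z)) = r"
    using association_scheme_row_sum[OF S] by blast
  have "(\<Sum>z\<in>pts S. c (rmap S z y)) = r" if "y \<in> pts S" for y
    using r[OF that] e that by (simp cong: sum.cong)
  then show ?thesis by (rule that)
qed

text \<open>Writing matrices of the wreath product as \<open>M\<^sub>1 \<otimes> J + 1 \<otimes> M\<^sub>2\<close> with \<open>M\<^sub>1\<close> zero on the diagonal, the
  product of two of them is
  \<open>|Y| (M\<^sub>1 N\<^sub>1) \<otimes> J + M\<^sub>1 \<otimes> (J N\<^sub>2) + N\<^sub>1 \<otimes> (M\<^sub>2 J) + 1 \<otimes> (M\<^sub>2 N\<^sub>2)\<close>,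
  where \<open>J N\<^sub>2\<close> and \<open>M\<^sub>2 J\<close> are multiples of \<open>J\<close>. The diagonal part of \<open>M\<^sub>1 N\<^sub>1\<close>
  contributes a multiple of \<open>1 \<otimes> J\<close>, which belongs to the second kind of summand.\<close>

lemma association_scheme_wreath:
  fixes S :: "('a, 'i) scheme" and T :: "('b, 'j) scheme"
  assumes S: "association_scheme S" and T: "association_scheme T"
  shows "association_scheme (wreath S T)"
proof -
  note idS = association_scheme_id[OF S] and idT = association_scheme_id[OF T]
  have finS: "finite (pts S)" "finite (rels S)" and finT: "finite (pts T)" "finite (rels T)"
    and surS: "(\<lambda>(x, y). rmap S x y) ` (pts S \<times> pts S) = rels S"
    and surT: "(\<lambda>(x, y). rmap T x y) ` (pts T \<times> pts T) = rels T"
    using S T by (auto simp: association_scheme_def)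
  have ptsW: "pts (wreath S T) = pts S \<times> pts T"
    and relsW: "rels (wreath S T) = (rels S - {scheme_id S}) <+> rels T"
    and rmapW: "rmap (wreath S T) (x, y) (x', y') =
      (if x \<noteq> x' then Inl (rmap S x x') else Inr (rmap T y y'))" for x y x' y'
    by (simp_all add: wreath_def)
  have "finite (pts (wreath S T))" "finite (rels (wreath S T))"
    using finS finT by (simp_all add: ptsW relsW)
  moreover have "(\<lambda>(u, v). rmap (wreath S T) u v) ` (pts (wreath S T) \<times> pts (wreath S T))
      = rels (wreath S T)" (is "?im = _")
  proof
    show "?im \<subseteq> rels (wreath S T)"
      using idS association_scheme_rmap[OF S] association_scheme_rmap[OF T]
      by (auto simp: ptsW relsW rmapW split: if_splits)
    show "rels (wreath S T) \<subseteq> ?im"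
    proof
      fix r assume "r \<in> rels (wreath S T)"
      then consider (Inl) i where "r = Inl i" "i \<in> rels S" "i \<noteq> scheme_id S"
        | (Inr) j where "r = Inr j" "j \<in> rels T"
        by (auto simp: relsW)
      then show "r \<in> ?im"
      proof cases
        case Inl
        obtain x x' where x: "x \<in> pts S" "x' \<in> pts S" "i = rmap S x x'"
          using Inl(2) by (auto simp flip: surS)
        obtain y where y: "y \<in> pts T" using idT(1) by blast
        have "x \<noteq> x'" using x Inl(3) idS(3) by metis
        then have "r = rmap (wreath S T) (x, y) (x', y)"
          using x Inl(1) by (simp add: rmapW)
        then show ?thesis using x y by (force simp: ptsW)
      next
        case Inr
        obtain y y' where y: "y \<in> pts T" "y' \<in> pts T" "j = rmap T y y'"
          using Inr(2) by (auto simp flip: surT)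
        obtain x where x: "x \<in> pts S" using idS(1) by blast
        have "r = rmap (wreath S T) (x, y) (x, y')"
          using y Inr(1) by (simp add: rmapW)
        then show ?thesis using x y by (force simp: ptsW)
      qed
    qed
  qed
  moreover have "\<exists>i0\<in>rels (wreath S T). \<forall>u\<in>pts (wreath S T). \<forall>v\<in>pts (wreath S T).
      rmap (wreath S T) u v = i0 \<longleftrightarrow> u = v"
    by (rule bexI[of _ "Inr (scheme_id T)"]) (use idT in \<open>auto simp: ptsW relsW rmapW\<close>)
  moreover have "\<exists>e. \<forall>u\<in>pts (wreath S T). \<forall>v\<in>pts (wreath S T).
      (\<Sum>w\<in>pts (wreath S T). c (rmap (wreath S T) u w) * d (rmap (wreath S T) w v))
        = e (rmap (wreath S T) u v)" for c d :: "'i + 'j \<Rightarrow> complex"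
  proof -
    \<comment> \<open>\<open>off b\<close> is the coefficient function of the factor \<open>M\<^sub>1\<close>: there is no relation
      \<open>Inl (scheme_id S)\<close>, so on the diagonal it has to be set to zero.\<close>
    define off where "off b i = (if i = scheme_id S then 0 else b (Inl i))"
      for b :: "'i + 'j \<Rightarrow> complex" and i
    have split: "b (rmap (wreath S T) (x, y) (x', y')) =
        off b (rmap S x x') + (if x = x' then b (Inr (rmap T y y')) else 0)"
      if "x \<in> pts S" "x' \<in> pts S" for b x y x' y'
      using idS(3)[OF that] by (auto simp: rmapW off_def)
    obtain e1 where e1: "\<forall>x\<in>pts S. \<forall>x'\<in>pts S.
        (\<Sum>z\<in>pts S. off c (rmap S x z) * off d (rmap S z x')) = e1 (rmap S x x')"
      using association_scheme_product_coefficients[OF S] by blast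
    obtain e2 where e2: "\<forall>y\<in>pts T. \<forall>y'\<in>pts T.
        (\<Sum>z\<in>pts T. c (Inr (rmap T y z)) * d (Inr (rmap T z y'))) = e2 (rmap T y y')"
      using association_scheme_product_coefficients[OF T, of "c \<circ> Inr" "d \<circ> Inr"] by auto
    obtain k where k: "\<And>y. y \<in> pts T \<Longrightarrow> (\<Sum>z\<in>pts T. c (Inr (rmap T y z))) = k"
      using association_scheme_row_sum[OF T, of "c \<circ> Inr"] by auto
    obtain l where l: "\<And>y. y \<in> pts T \<Longrightarrow> (\<Sum>z\<in>pts T. d (Inr (rmap T z y))) = l"
      using association_scheme_column_sum[OF T, of "d \<circ> Inr"] by auto
    define n where "n = (of_nat (card (pts T)) :: complex)"
    \<comment> \<open>The diagonal value \<open>e1 (scheme_id S)\<close> of \<open>M\<^sub>1 N\<^sub>1\<close> reappears in the coefficients of the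
      relations inside a block.\<close>
    define e where "e = case_sum
        (\<lambda>i. n * e1 i + off c i * l + off d i * k)
        (\<lambda>j. n * e1 (scheme_id S) + e2 j)"
    have "(\<Sum>w\<in>pts (wreath S T).
          c (rmap (wreath S T) (x, y) w) * d (rmap (wreath S T) w (x', y')))
        = e (rmap (wreath S T) (x, y) (x', y'))"
      if x: "x \<in> pts S" "x' \<in> pts S" and y: "y \<in> pts T" "y' \<in> pts T" for x y x' y'
    proof -
      have inner: "(\<Sum>w\<in>pts T. (off c (rmap S x z) + (if x = z then c (Inr (rmap T y w)) else 0)) *
            (off d (rmap S z x') + (if z = x' then d (Inr (rmap T w y')) else 0)))
          = n * (off c (rmap S x z) * off d (rmap S z x'))
            + (if z = x' then off c (rmap S x z) * l else 0)
            + (if x = z then off d (rmap S z x') * k else 0)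
            + (if x = z then if z = x' then e2 (rmap T y y') else 0 else 0)" for z
      proof -
        have "(off c (rmap S x z) + (if x = z then c (Inr (rmap T y w)) else 0)) *
              (off d (rmap S z x') + (if z = x' then d (Inr (rmap T w y')) else 0))
          = off c (rmap S x z) * off d (rmap S z x')
            + (if z = x' then off c (rmap S x z) else 0) * d (Inr (rmap T w y'))
            + (if x = z then off d (rmap S z x') else 0) * c (Inr (rmap T y w))
            + (if x = z \<and> z = x' then 1 else 0) * (c (Inr (rmap T y w)) * d (Inr (rmap T w y')))"
          for w
          by (simp add: algebra_simps)
        then show ?thesis
          using y by (simp add: sum.distrib n_def k l e2 flip: sum_distrib_left)
      qed
      have "(\<Sum>w\<in>pts (wreath S T).
            c (rmap (wreath S T) (x, y) w) * d (rmap (wreath S T) w (x', y')))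
          = (\<Sum>z\<in>pts S. \<Sum>w\<in>pts T.
              c (rmap (wreath S T) (x, y) (z, w)) * d (rmap (wreath S T) (z, w) (x', y')))"
        by (simp add: ptsW sum.cartesian_product case_prod_unfold)
      also have "\<dots> = (\<Sum>z\<in>pts S. n * (off c (rmap S x z) * off d (rmap S z x'))
            + (if z = x' then off c (rmap S x z) * l else 0)
            + (if x = z then off d (rmap S z x') * k else 0)
            + (if x = z then if z = x' then e2 (rmap T y y') else 0 else 0))"
        using x by (simp add: split inner cong: sum.cong)
      also have "\<dots> = n * e1 (rmap S x x') + off c (rmap S x x') * l + off d (rmap S x x') * k
            + (if x = x' then e2 (rmap T y y') else 0)"
        using x finS e1 by (simp add: sum.distrib flip: sum_distrib_left)
      also have "\<dots> = e (rmap (wreath S T) (x, y) (x', y'))"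
        using idS(3)[OF x] by (auto simp: e_def rmapW off_def)
      finally show ?thesis .
    qed
    then show ?thesis by (intro exI[of _ e]) (auto simp: ptsW)
  qed
  moreover have "\<exists>e. \<forall>u\<in>pts (wreath S T). \<forall>v\<in>pts (wreath S T).
      c (rmap (wreath S T) v u) = e (rmap (wreath S T) u v)" for c :: "'i + 'j \<Rightarrow> complex"
  proof -
    obtain e1 where e1: "\<forall>x\<in>pts S. \<forall>x'\<in>pts S. c (Inl (rmap S x' x)) = e1 (rmap S x x')"
      using association_scheme_transpose_coefficients[OF S, of "c \<circ> Inl"] by auto
    obtain e2 where e2: "\<forall>y\<in>pts T. \<forall>y'\<in>pts T. c (Inr (rmap T y' y)) = e2 (rmap T y y')"
      using association_scheme_transpose_coefficients[OF T, of "c \<circ> Inr"] by auto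
    show ?thesis
      by (rule exI[of _ "case_sum e1 e2"]) (auto simp: ptsW rmapW e1 e2)
  qed
  ultimately show ?thesis unfolding association_scheme_iff by (intro conjI allI)
qed

lemma association_scheme_iterated_wreath:
  assumes S: "\<And>k. 1 \<le> k \<Longrightarrow> association_scheme (S k)" and n: "1 \<le> n"
  shows "association_scheme (iterated_wreath S n)"
  using n
proof (induction n rule: dec_induct)
  case base
  have "scheme_isomorphism (S 1) (iterated_wreath S 1) (\<lambda>a. \<lambda>k\<in>{1..1}. a) (Pair 1)"
  proof -
    have [simp]: "wreath_index (Suc 0) x y = Suc 0" for x y :: "nat \<Rightarrow> 'a"
      using wreath_index_last[of "Suc 0" x y] by simp
    have "bij_betw (\<lambda>a. \<lambda>k\<in>{1..1}. a) (pts (S 1)) (\<Pi>\<^sub>E k\<in>{1..1}. pts (S k))"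
      by (rule bij_betw_byWitness[where f' = "\<lambda>x. x 1"])
        (auto simp: PiE_iff extensional_def fun_eq_iff split: if_splits)
    moreover have "bij_betw (Pair (Suc 0)) (rels (S 1)) ({Suc 0} \<times> rels (S 1))"
      by (rule bij_betw_byWitness[where f' = snd]) auto
    moreover have "rmap (S 1) x y \<in> rels (S 1)" if "x \<in> pts (S 1)" "y \<in> pts (S 1)" for x y
      using association_scheme_rmap[OF S[of 1]] that by simp
    ultimately show ?thesis
      by (simp add: scheme_isomorphism_def scheme_morphism_def iterated_wreath_def Let_def
          bij_betw_imp_surj_on)
  qed
  then show ?case
    using scheme_isomorphism_preserves_association_scheme S by blast
next
  case (step n)
  have "association_scheme (wreath (iterated_wreath S n) (S (Suc n)))"
    by (rule association_scheme_wreath[OF step.IH S]) simp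
  then show ?case
    using scheme_isomorphism_preserves_association_scheme[OF iterated_wreath_Suc[of S, OF S step.hyps(1)]]
    by blast
qed

section \<open>The projective system\<close>

lemma composite_wreath_point_step:
  assumes "m \<le> n" "x \<in> extensional {1..n}"
  shows "composite wreath_point_step n m x = restrict x {1..m}"
  using assms
proof (induction n arbitrary: x)
  case 0
  then show ?case by (simp add: extensional_restrict)
next
  case (Suc n)
  show ?case
  proof (cases "m \<le> n")
    case True
    have "composite wreath_point_step (Suc n) m x =
        composite wreath_point_step n m (restrict x {1..n})"
      using True by (simp add: wreath_point_step_def)
    also have "\<dots> = restrict (restrict x {1..n}) {1..m}"
      by (rule Suc.IH[OF True]) (rule restrict_extensional)
    also have "\<dots> = restrict x {1..m}"
      using True by (simp add: restrict_restrict Int_absorb1)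
    finally show ?thesis .
  next
    case False
    then have "m = Suc n" using Suc.prems by simp
    then show ?thesis using Suc.prems by (simp add: extensional_restrict)
  qed
qed

text \<open>A relation of index \<open>k > m\<close> becomes the identity at level \<open>k - 1\<close>, which is again of highest index
  there and so is sent to the identity at every lower level.\<close>

lemma composite_wreath_relation_step:
  assumes "m \<le> n" "k \<le> n"
  shows "composite (wreath_relation_step S) n m (k, i) =
    (if k \<le> m then (k, i) else (m, scheme_id (S m)))"
  using assms
proof (induction n arbitrary: k i)
  case (Suc n)
  show ?case
  proof (cases "m \<le> n")
    case True
    show ?thesis
      using True Suc.prems Suc.IH[OF True, of n "scheme_id (S n)"] Suc.IH[OF True, of k i]
      by (cases "k = Suc n") (auto simp: wreath_relation_step_def)
  qed (use Suc.prems in \<open>simp\<close>)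
qed simp

lemma pts_iterated_wreath: "pts (iterated_wreath S n) = (\<Pi>\<^sub>E k\<in>{1..n}. pts (S k))"
  by (simp add: iterated_wreath_def)

text \<open>The lower bound on \<open>k\<close> sits under the implication because the last summand, of index \<open>n\<close>, is
  present for every \<open>n\<close>, even for \<open>n = 0\<close>.\<close>

lemma rels_iterated_wreath_iff:
  shows "(k, i) \<in> rels (iterated_wreath S n) \<longleftrightarrow>
    k \<le> n \<and> i \<in> rels (S k) \<and> (k < n \<longrightarrow> 1 \<le> k \<and> i \<noteq> scheme_id (S k))"
  by (cases "k = n") (auto simp: iterated_wreath_def)

text \<open>If the tuples first differ at \<open>k < m\<close>, truncation to length \<open>m\<close> does not change their relation.
  Otherwise the truncated tuples are related by their \<open>m\<close>-th components: this is the original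
  relation if \<open>k = m\<close>, and the identity if \<open>k > m\<close>, since then these components agree.\<close>

lemma rmap_iterated_wreath_restrict:
  assumes S: "\<And>k. 1 \<le> k \<Longrightarrow> association_scheme (S k)" and m: "1 \<le> m" "m \<le> n"
    and xy: "x \<in> pts (iterated_wreath S n)" "y \<in> pts (iterated_wreath S n)"
  shows "rmap (iterated_wreath S m) (restrict x {1..m}) (restrict y {1..m}) =
    composite (wreath_relation_step S) n m (rmap (iterated_wreath S n) x y)"
proof -
  let ?x = "restrict x {1..m}" and ?y = "restrict y {1..m}"
  have R: "rmap (iterated_wreath S n) x y = (k, rmap (S k) (x k) (y k))"
    if "wreath_index n x y = k" for n k x y
    using that by (simp add: iterated_wreath_def Let_def)
  have refl: "rmap (S m) (x m) (y m) = scheme_id (S m)" if "x m = y m"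
    using association_scheme_id(3)[OF S[OF m(1)], of "x m" "y m"] that xy m
    by (auto simp: pts_iterated_wreath PiE_iff)
  have n: "1 \<le> n" using m by simp
  show ?thesis
    using n
  proof (cases rule: wreath_index_cases[of n x y])
    case (differ k)
    have "wreath_index n x y = k" by (rule wreath_index_differ) (use differ in auto)
    note Rn = R[OF this]
    show ?thesis
    proof (cases "k < m")
      case True
      have "wreath_index m ?x ?y = k"
        by (rule wreath_index_differ) (use differ True in auto)
      from R[OF this] Rn show ?thesis
        using True differ m by (simp add: composite_wreath_relation_step)
    next
      case False
      have "wreath_index m ?x ?y = m"
        by (rule wreath_index_last) (use differ False m in auto)
      from R[OF this] Rn show ?thesis
        using False differ m refl by (auto simp: composite_wreath_relation_step)
    qed
  next
    case last
    have "wreath_index m ?x ?y = m"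
      by (rule wreath_index_last) (use last m in auto)
    from R[OF this] R[OF wreath_index_last[OF n last]] show ?thesis
      using last m refl by (auto simp: composite_wreath_relation_step)
  qed
qed

lemma projective_system_iterated_wreath:
  assumes S: "\<And>k. 1 \<le> k \<Longrightarrow> association_scheme (S k)"
  shows "projective_system {1..} (iterated_wreath S)
    (composite wreath_point_step) (composite (wreath_relation_step S))"
  unfolding projective_system_def
proof (intro conjI ballI impI)
  show "directed_set {1::nat..}"
    unfolding directed_set_def by (metis atLeast_iff empty_iff linear order_refl)
  show "association_scheme (iterated_wreath S l)" if "l \<in> {1..}" for l
    using association_scheme_iterated_wreath[OF S] that by simp
  show "composite wreath_point_step l l x = x" "composite (wreath_relation_step S) l l i = i"
    for l x i by (simp_all add: composite_self)
next
  fix l m n x i assume l: "l \<in> {1::nat..}" "m \<in> {1..}" "n \<in> {1..}" "n \<le> m" "m \<le> l"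
  show "composite wreath_point_step l n x =
      composite wreath_point_step m n (composite wreath_point_step l m x)"
    if "x \<in> pts (iterated_wreath S l)"
  proof -
    have "x \<in> extensional {1..l}" using that by (simp add: pts_iterated_wreath PiE_iff)
    then show ?thesis
      using l by (simp add: composite_wreath_point_step restrict_restrict Int_absorb1)
  qed
  show "composite (wreath_relation_step S) l n i =
      composite (wreath_relation_step S) m n (composite (wreath_relation_step S) l m i)"
    if "i \<in> rels (iterated_wreath S l)"
    using that l by (cases i) (auto simp: rels_iterated_wreath_iff composite_wreath_relation_step)
next
  fix l m assume l: "l \<in> {1::nat..}" and m: "m \<in> {1::nat..}" and ml: "m \<le> l"
  have point: "composite wreath_point_step l m x = restrict x {1..m}"
    if "x \<in> pts (iterated_wreath S l)" for x
    using that ml by (intro composite_wreath_point_step) (simp_all add: pts_iterated_wreath PiE_iff)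
  have "pts (iterated_wreath S m) \<subseteq> composite wreath_point_step l m ` pts (iterated_wreath S l)"
  proof
    fix x assume x: "x \<in> pts (iterated_wreath S m)"
    \<comment> \<open>A truncated tuple is lifted by filling the missing components with arbitrary points.\<close>
    have "pts (S k) \<noteq> {}" if "1 \<le> k" for k
      using association_scheme_id(1)[OF S[OF that]] .
    then have "\<forall>k. \<exists>a. 1 \<le> k \<longrightarrow> a \<in> pts (S k)" by blast
    then obtain a where a: "\<And>k. 1 \<le> k \<Longrightarrow> a k \<in> pts (S k)" by metis
    define x' where "x' = (\<lambda>k\<in>{1..l}. if k \<le> m then x k else a k)"
    have x': "x' \<in> pts (iterated_wreath S l)"
      using x a by (auto simp: x'_def pts_iterated_wreath PiE_iff)
    have "x = restrict x' {1..m}"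
      using x ml by (auto simp: x'_def pts_iterated_wreath PiE_iff extensional_def fun_eq_iff)
    then show "x \<in> composite wreath_point_step l m ` pts (iterated_wreath S l)"
      using x' point by auto
  qed
  moreover have "composite wreath_point_step l m ` pts (iterated_wreath S l)
      \<subseteq> pts (iterated_wreath S m)"
    using ml by (auto simp: point) (auto simp: pts_iterated_wreath PiE_iff)
  moreover have "composite (wreath_relation_step S) l m ` rels (iterated_wreath S l)
      \<subseteq> rels (iterated_wreath S m)"
    using l m ml association_scheme_id(2)[OF S[of m]]
    by (auto simp: rels_iterated_wreath_iff composite_wreath_relation_step)
  ultimately show "surjective_scheme_morphism (iterated_wreath S l) (iterated_wreath S m)
      (composite wreath_point_step l m) (composite (wreath_relation_step S) l m)"
    unfolding surjective_scheme_morphism_def scheme_morphism_def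
    using rmap_iterated_wreath_restrict[OF S _ ml] m point by auto
qed

section \<open>The two limits\<close>

lemma Hausdorff_space_projective_limit: "Hausdorff_space (projective_limit L A f)"
  unfolding projective_limit_def
  by (intro Hausdorff_space_subtopology) (simp add: Hausdorff_space_product_topology)

lemma topspace_projective_limit: "topspace (projective_limit L A f) = projective_limit_set L A f"
  by (auto simp: projective_limit_def projective_limit_set_def)

lemma continuous_map_projective_limit:
  assumes "f \<in> topspace X \<rightarrow> projective_limit_set L A p"
    and "\<And>l. l \<in> L \<Longrightarrow> continuous_map X (discrete_topology (A l)) (\<lambda>x. f x l)"
  shows "continuous_map X (projective_limit L A p) f"
  using assms
  by (auto simp: projective_limit_def continuous_map_in_subtopology continuous_map_componentwise
      projective_limit_set_def PiE_iff Pi_iff)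

text \<open>A compatible family \<open>z\<close> is recovered from its diagonal \<open>z k k\<close>, because \<open>z n\<close> and \<open>z k\<close> agree in
  component \<open>k\<close> whenever \<open>k \<le> n\<close>.\<close>

lemma projective_limit_points:
  "projective_limit_set {1..} (\<lambda>n. pts (iterated_wreath S n)) (composite wreath_point_step)
    = product_to_limit ` (\<Pi>\<^sub>E k\<in>{1..}. pts (S k))" (is "?L = _ ` ?P")
proof
  show "product_to_limit ` ?P \<subseteq> ?L"
  proof
    fix z assume "z \<in> product_to_limit ` ?P"
    then obtain x where x: "z = product_to_limit x" "x \<in> ?P" by blast
    show "z \<in> ?L"
      using x by (auto simp: projective_limit_set_def product_to_limit_def pts_iterated_wreath PiE_iff
          composite_wreath_point_step restrict_restrict Int_absorb1)
  qed
  show "?L \<subseteq> product_to_limit ` ?P"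
  proof
    fix z assume z: "z \<in> ?L"
    define x where "x = (\<lambda>k\<in>{1..}. z k k)"
    have zn: "z n \<in> (\<Pi>\<^sub>E k\<in>{1..n}. pts (S k))" if "1 \<le> n" for n
      using z that by (auto simp: projective_limit_set_def pts_iterated_wreath)
    have zk: "z n k = z k k" if "1 \<le> k" "k \<le> n" for n k
    proof -
      have "composite wreath_point_step n k (z n) = z k"
        using z that by (auto simp: projective_limit_set_def)
      moreover have "composite wreath_point_step n k (z n) = restrict (z n) {1..k}"
        by (rule composite_wreath_point_step) (use zn[of n] that in \<open>auto simp: PiE_iff\<close>)
      ultimately show ?thesis using that by (metis atLeastAtMost_iff order_refl restrict_apply')
    qed
    have "x \<in> ?P"
      using zn by (auto simp: x_def PiE_iff)
    moreover have "z = product_to_limit x"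
    proof
      fix n
      show "z n = product_to_limit x n"
      proof (cases "1 \<le> n")
        case True
        show ?thesis
          using zn[OF True] zk[of _ n] True
          by (auto simp: product_to_limit_def x_def PiE_iff extensional_def fun_eq_iff)
      next
        case False
        then show ?thesis
          using z by (simp add: product_to_limit_def projective_limit_set_def PiE_iff extensional_def)
      qed
    qed
    ultimately show "z \<in> product_to_limit ` ?P" by blast
  qed
qed

lemma inj_on_product_to_limit: "inj_on product_to_limit (\<Pi>\<^sub>E k\<in>{1..}. A k)"
proof (rule inj_onI)
  fix x y assume xy: "x \<in> (\<Pi>\<^sub>E k\<in>{1..}. A k)" "y \<in> (\<Pi>\<^sub>E k\<in>{1..}. A k)"
    and eq: "product_to_limit x = product_to_limit y"
  show "x = y"
  proof (rule PiE_ext[OF xy])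
    fix k :: nat assume "k \<in> {1..}"
    then show "x k = y k"
      using fun_cong[OF fun_cong[OF eq, of k], of k] by (simp add: product_to_limit_def)
  qed
qed

lemma finite_product_discrete_topology:
  assumes "finite I"
  shows "product_topology (\<lambda>i. discrete_topology (A i)) I = discrete_topology (Pi\<^sub>E I A)"
proof -
  have "openin (product_topology (\<lambda>i. discrete_topology (A i)) I) {x}" if "x \<in> Pi\<^sub>E I A" for x
  proof -
    have "{x} = (\<Pi>\<^sub>E i\<in>I. {x i})"
      using that PiE_singleton[of x I] by (simp add: PiE_iff)
    moreover have "openin (product_topology (\<lambda>i. discrete_topology (A i)) I) (\<Pi>\<^sub>E i\<in>I. {x i})"
      using assms that by (auto simp: openin_PiE PiE_iff)
    ultimately show ?thesis by simp
  qed
  then have "discrete_topology (Pi\<^sub>E I A) = product_topology (\<lambda>i. discrete_topology (A i)) I"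
    unfolding discrete_topology_unique by (simp add: comp_def)
  then show ?thesis by (rule sym)
qed

text \<open>Continuity at level \<open>n\<close> uses that a finite product of discrete spaces is discrete, so that
  truncation is continuous as soon as each component is.\<close>

lemma homeomorphic_map_product_to_limit:
  assumes fin: "\<And>k. 1 \<le> k \<Longrightarrow> finite (pts (S k))"
  shows "homeomorphic_map
    (product_topology (\<lambda>k. discrete_topology (pts (S k))) {1..})
    (projective_limit {1..} (\<lambda>n. pts (iterated_wreath S n)) (composite wreath_point_step))
    product_to_limit" (is "homeomorphic_map ?X ?Y _")
proof (rule continuous_imp_homeomorphic_map)
  show "compact_space ?X"
    using fin by (simp add: compact_space_product_topology compact_space_discrete_topology)
  show "Hausdorff_space ?Y" by (rule Hausdorff_space_projective_limit)
  show "product_to_limit ` topspace ?X = topspace ?Y"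
    by (simp only: topspace_projective_limit projective_limit_points topspace_product_topology
        topspace_discrete_topology comp_def)
  show "inj_on product_to_limit (topspace ?X)"
    using inj_on_product_to_limit by simp
  show "continuous_map ?X ?Y product_to_limit"
  proof (rule continuous_map_projective_limit)
    fix n :: nat assume n: "n \<in> {1..}"
    have "discrete_topology (pts (iterated_wreath S n)) =
        product_topology (\<lambda>k. discrete_topology (pts (S k))) {1..n}"
      by (simp add: finite_product_discrete_topology pts_iterated_wreath)
    moreover have "continuous_map ?X (product_topology (\<lambda>k. discrete_topology (pts (S k))) {1..n})
        (\<lambda>x. restrict x {1..n})"
      by (auto simp: continuous_map_componentwise
          intro!: continuous_map_product_projection)
    ultimately show "continuous_map ?X (discrete_topology (pts (iterated_wreath S n)))
        (\<lambda>x. product_to_limit x n)"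
      using n by (simp add: product_to_limit_def)
  qed (simp only: projective_limit_points topspace_product_topology topspace_discrete_topology
      comp_def, blast)
qed

lemma compactification_to_limit_apply:
  "1 \<le> n \<Longrightarrow> compactification_to_limit S None n = (n, scheme_id (S n))"
  "1 \<le> n \<Longrightarrow> compactification_to_limit S (Some (k, i)) n =
    (if k \<le> n then (k, i) else (n, scheme_id (S n)))"
  by (simp_all add: compactification_to_limit_def)

text \<open>If a compatible family is \<open>(k, i)\<close>, not the identity, at some level \<open>n\<close>, then it is determined by
  \<open>(k, i)\<close>: below \<open>n\<close> by compatibility, and above \<open>n\<close> because the only element mapping to a
  non-identity relation is that relation itself.\<close>

lemma projective_limit_relations:
  fixes S :: "nat \<Rightarrow> ('a, 'i) scheme"
  assumes S: "\<And>k. 1 \<le> k \<Longrightarrow> association_scheme (S k)"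
  defines "D \<equiv> SIGMA k:{1..}. rels (S k) - {scheme_id (S k)}"
  shows "projective_limit_set {1..} (\<lambda>n. rels (iterated_wreath S n))
      (composite (wreath_relation_step S))
    = compactification_to_limit S ` insert None (Some ` D)" (is "?L = ?c ` ?E")
proof
  show "?c ` ?E \<subseteq> ?L"
  proof
    fix z assume "z \<in> ?c ` ?E"
    then obtain d where d: "d \<in> ?E" "z = ?c d" by blast
    have "z \<in> (\<Pi>\<^sub>E n\<in>{1..}. rels (iterated_wreath S n))"
      unfolding PiE_iff
    proof
      show "\<forall>n\<in>{1..}. z n \<in> rels (iterated_wreath S n)"
        using d association_scheme_id(2)[OF S]
        by (auto simp: compactification_to_limit_apply rels_iterated_wreath_iff D_def split: if_splits)
    qed (simp add: d compactification_to_limit_def)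
    moreover have "composite (wreath_relation_step S) l m (z l) = z m"
      if "l \<in> {1..}" "m \<in> {1..}" "m \<le> l" for l m
      using that d by (auto simp: compactification_to_limit_apply composite_wreath_relation_step)
    ultimately show "z \<in> ?L" by (simp add: projective_limit_set_def)
  qed
  show "?L \<subseteq> ?c ` ?E"
  proof
    fix z assume z: "z \<in> ?L"
    then have zn: "z n \<in> rels (iterated_wreath S n)" if "1 \<le> n" for n
      using that by (auto simp: projective_limit_set_def)
    have comp: "composite (wreath_relation_step S) n m (z n) = z m" if "1 \<le> m" "m \<le> n" for m n
      using z that by (auto simp: projective_limit_set_def)
    have ext: "z = ?c d" if "\<And>n. 1 \<le> n \<Longrightarrow> z n = ?c d n" for d
    proof
      fix n show "z n = ?c d n"
        using that[of n] z
        by (cases "1 \<le> n")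
          (auto simp: compactification_to_limit_def projective_limit_set_def PiE_iff extensional_def)
    qed
    show "z \<in> ?c ` ?E"
    proof (cases "\<exists>n\<ge>1. z n \<noteq> (n, scheme_id (S n))")
      case False
      then have "z = ?c None" by (intro ext) (simp add: compactification_to_limit_apply)
      then show ?thesis by blast
    next
      case True
      then obtain n k i where n: "1 \<le> n" "z n \<noteq> (n, scheme_id (S n))" and ki: "z n = (k, i)"
        by (metis surj_pair)
      have k: "1 \<le> k" "k \<le> n" "i \<in> rels (S k)" "i \<noteq> scheme_id (S k)"
        using zn[OF n(1)] n ki by (auto simp: rels_iterated_wreath_iff) 
      have "z = ?c (Some (k, i))"
      proof (rule ext)
        fix m :: nat assume m: "1 \<le> m"
        show "z m = ?c (Some (k, i)) m"
        proof (cases "m \<le> n")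
          case True
          then show ?thesis
            using comp[OF m True] m k ki
            by (simp add: compactification_to_limit_apply composite_wreath_relation_step)
        next
          case False
          obtain k' i' where ki': "z m = (k', i')" by force
          have "k' \<le> m" using zn[OF m] m ki' by (simp add: rels_iterated_wreath_iff)
          then have "z n = (if k' \<le> n then (k', i') else (n, scheme_id (S n)))"
            using comp[of n m] n(1) False ki' by (simp add: composite_wreath_relation_step)
          then have "z m = (k, i)" using n(2) ki ki' by (auto split: if_splits)
          then show ?thesis using False k m by (simp add: compactification_to_limit_apply)
        qed
      qed
      moreover have "(k, i) \<in> D" using k by (simp add: D_def)
      ultimately show ?thesis by blast
    qed
  qed
qed

text \<open>At level \<open>max k l\<close> both \<open>(k, i)\<close> and \<open>(l, j)\<close> are visible, and at level \<open>k\<close> the relation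
  \<open>(k, i)\<close> is distinguished from the identity.\<close>

lemma inj_on_compactification_to_limit:
  "inj_on (compactification_to_limit S)
    (insert None (Some ` (SIGMA k:{1..}. rels (S k) - {scheme_id (S k)})))"
    (is "inj_on ?c (insert None (Some ` ?D))")
proof -
  have None: "?c (Some (k, i)) \<noteq> ?c None" if "(k, i) \<in> ?D" for k i
    using that by (auto simp: compactification_to_limit_apply dest: fun_cong[of _ _ k])
  have Some: "(k, i) = (l, j)" if "(k, i) \<in> ?D" and eq: "?c (Some (k, i)) = ?c (Some (l, j))"
    for k i l j
    using fun_cong[OF eq, of "max k l"] that(1) by (auto simp: compactification_to_limit_apply)
  show ?thesis
    by (rule inj_onI) (use None Some in \<open>auto; metis\<close>)
qed

text \<open>For continuity at level \<open>n\<close>, a set of relations containing the identity omits only finitely many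
  points of \<open>D\<close> in its preimage, all of index at most \<open>n\<close>; a set without the identity has its
  preimage inside the discrete part.\<close>

lemma homeomorphic_map_compactification_to_limit:
  fixes S :: "nat \<Rightarrow> ('a, 'i) scheme"
  assumes S: "\<And>k. 1 \<le> k \<Longrightarrow> association_scheme (S k)"
  defines "D \<equiv> SIGMA k:{1..}. rels (S k) - {scheme_id (S k)}"
  shows "homeomorphic_map (Alexandroff_compactification (discrete_topology D))
    (projective_limit {1..} (\<lambda>n. rels (iterated_wreath S n)) (composite (wreath_relation_step S)))
    (compactification_to_limit S)" (is "homeomorphic_map ?X ?Y ?c")
proof (rule continuous_imp_homeomorphic_map)
  have topX: "topspace ?X = insert None (Some ` D)" by simp
  have limit: "projective_limit_set {1..} (\<lambda>n. rels (iterated_wreath S n))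
      (composite (wreath_relation_step S)) = ?c ` topspace ?X"
    unfolding topX unfolding D_def by (rule projective_limit_relations[of S, OF S])
  show "compact_space ?X" by (rule compact_space_Alexandroff_compactification)
  show "Hausdorff_space ?Y" by (rule Hausdorff_space_projective_limit)
  show "?c ` topspace ?X = topspace ?Y"
    by (simp only: topspace_projective_limit limit)
  show "inj_on ?c (topspace ?X)"
    unfolding topX unfolding D_def by (rule inj_on_compactification_to_limit)
  show "continuous_map ?X ?Y ?c"
  proof (rule continuous_map_projective_limit)
    show into: "?c \<in> topspace ?X \<rightarrow> projective_limit_set {1..} (\<lambda>n. rels (iterated_wreath S n))
        (composite (wreath_relation_step S))"
      unfolding limit by blast
    fix n :: nat assume n: "n \<in> {1..}"
    define F where "F U = {d \<in> D. ?c (Some d) n \<notin> U}" for U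
    have "openin ?X {d \<in> topspace ?X. ?c d n \<in> U}" for U
    proof (cases "?c None n \<in> U")
      case True
      have "F U \<subseteq> (SIGMA k:{1..n}. rels (S k))"
        using True n by (auto simp: F_def D_def compactification_to_limit_apply split: if_splits)
      moreover have "finite (SIGMA k:{1..n}. rels (S k))"
        using S by (auto simp: association_scheme_def)
      ultimately have "finite (F U)" by (rule finite_subset)
      moreover have "{d \<in> topspace ?X. ?c d n \<in> U} = insert None (Some ` (D - F U))"
        using True unfolding topX by (auto simp: F_def)
      moreover have "F U \<subseteq> D" by (auto simp: F_def)
      ultimately show ?thesis
        unfolding openin_Alexandroff_compactification_discrete by blast
    next
      case False
      then have "{d \<in> topspace ?X. ?c d n \<in> U} = Some ` (D - F U)"
        unfolding topX by (auto simp: F_def)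
      then show ?thesis
        unfolding openin_Alexandroff_compactification_discrete by blast
    qed
    moreover have "?c d n \<in> rels (iterated_wreath S n)" if "d \<in> topspace ?X" for d
      using funcset_mem[OF into that] n by (auto simp: projective_limit_set_def)
    ultimately show "continuous_map ?X (discrete_topology (rels (iterated_wreath S n)))
        (\<lambda>d. ?c d n)"
      by (simp add: continuous_map_def Pi_iff del: topspace_Alexandroff_compactification)
  qed
qed

theorem proposition4p10:
  fixes S :: "nat \<Rightarrow> ('a, 'i) scheme"
  assumes "\<And>n. 1 \<le> n \<Longrightarrow> association_scheme (S n)"
  shows
    "projective_system {1..} (iterated_wreath S)
       (composite wreath_point_step) (composite (wreath_relation_step S)) \<and>
     homeomorphic_map
       (product_topology (\<lambda>k. discrete_topology (pts (S k))) {1..})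
       (projective_limit {1..} (\<lambda>n. pts (iterated_wreath S n)) (composite wreath_point_step))
       product_to_limit \<and>
     compact_space
       (projective_limit {1..} (\<lambda>n. pts (iterated_wreath S n)) (composite wreath_point_step)) \<and>
     Hausdorff_space
       (projective_limit {1..} (\<lambda>n. pts (iterated_wreath S n)) (composite wreath_point_step)) \<and>
     homeomorphic_map
       (Alexandroff_compactification
          (discrete_topology (SIGMA k:{1..}. rels (S k) - {scheme_id (S k)})))
       (projective_limit {1..} (\<lambda>n. rels (iterated_wreath S n)) (composite (wreath_relation_step S)))
       (compactification_to_limit S)"
proof -
  have fin: "finite (pts (S k))" if "1 \<le> k" for k
    using assms[OF that] by (simp add: association_scheme_def)
  note points = homeomorphic_map_product_to_limit[of S, OF fin]
  have "compact_space (product_topology (\<lambda>k. discrete_topology (pts (S k))) {1..})"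
    using fin by (simp add: compact_space_product_topology compact_space_discrete_topology)
  then have "compact_space
      (projective_limit {1..} (\<lambda>n. pts (iterated_wreath S n)) (composite wreath_point_step))"
    using homeomorphic_compact_space[OF homeomorphic_map_imp_homeomorphic_space[OF points]] by blast
  then show ?thesis
    using projective_system_iterated_wreath[of S, OF assms] points Hausdorff_space_projective_limit
      homeomorphic_map_compactification_to_limit[of S, OF assms] by (intro conjI)
qed

end
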